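(* For every integer $\ell>1$ with $2\nmid \ell$ and $3\nmid\ell$, the disjoint union $K_4\cup C_\ell$ of the complete graph on $4$ vertices and the cycle of length $\ell$ is not a monoid graph.
   Context: All monoids and graphs are finite. For a monoid $M$ and $C\subseteq M$, $\underline{\mathrm{Cay}}(M,C)$ is the simple undirected graph with vertex set $M$ in which distinct $x,y$ are adjacent if and only if $y=xc$ or $x=yc$ for some $c\in C$. A monoid graph is a simple undirected graph isomorphic to $\underline{\mathrm{Cay}}(M,C)$ for some monoid $M$ and some $C\subseteq M$. *)

theory Defs
  imports "HOL-Algebra.Group"
begin

record 'v ugraph =
  verts :: "'v set"
  edges :: "'v set set"

definition simple_graph :: "'v ugraph \<Rightarrow> bool" where
  "simple_graph G \<longleftrightarrow> finite (verts G) \<and> (\<forall>e\<in>edges G. e \<subseteq> verts G \<and> card e = 2)"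

definition graph_iso :: "'v ugraph \<Rightarrow> 'w ugraph \<Rightarrow> bool" where
  "graph_iso G H \<longleftrightarrow>
     (\<exists>f. bij_betw f (verts G) (verts H) \<and> edges H = (\<lambda>e. f ` e) ` edges G)"

definition complete_graph :: "nat \<Rightarrow> nat ugraph" where
  "complete_graph n =
     \<lparr>verts = {..<n}, edges = {{i, j} | i j. i < n \<and> j < n \<and> i \<noteq> j}\<rparr>"

text \<open>This is the cycle of length \<open>n\<close> only for \<open>n \<ge> 3\<close>.\<close>

definition cycle_graph :: "nat \<Rightarrow> nat ugraph" where
  "cycle_graph n = \<lparr>verts = {..<n}, edges = {{i, Suc i mod n} | i. i < n}\<rparr>"

definition disjoint_union :: "'v ugraph \<Rightarrow> 'w ugraph \<Rightarrow> ('v + 'w) ugraph" where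
  "disjoint_union G H =
     \<lparr>verts = verts G <+> verts H,
      edges = (\<lambda>e. Inl ` e) ` edges G \<union> (\<lambda>e. Inr ` e) ` edges H\<rparr>"

definition cayley_graph :: "('m, 'b) monoid_scheme \<Rightarrow> 'm set \<Rightarrow> 'm ugraph" where
  "cayley_graph M C =
     \<lparr>verts = carrier M,
      edges = {{x, y} | x y. x \<in> carrier M \<and> y \<in> carrier M \<and> x \<noteq> y \<and>
                 (\<exists>c\<in>C. y = x \<otimes>\<^bsub>M\<^esub> c \<or> x = y \<otimes>\<^bsub>M\<^esub> c)}\<rparr>"

text \<open>HOL cannot quantify existentially over the type of the elements of the monoid, so this
  type is a parameter. A statement that a graph is not a monoid graph is to be made with
  a free type variable \<open>'m\<close>, and then ranges over monoids on all types.\<close>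

definition monoid_graph :: "'m itself \<Rightarrow> 'v ugraph \<Rightarrow> bool" where
  "monoid_graph (_ :: 'm itself) G \<longleftrightarrow>
     simple_graph G \<and>
     (\<exists>(M :: 'm monoid) C. monoid M \<and> finite (carrier M) \<and> C \<subseteq> carrier M \<and>
        graph_iso G (cayley_graph M C))"

lemma simple_graph_cayley_graph:
  "finite (carrier M) \<Longrightarrow> simple_graph (cayley_graph M C)"
  by (auto simp: simple_graph_def cayley_graph_def)

lemma simple_graph_complete_graph: "simple_graph (complete_graph n)"
  by (auto simp: simple_graph_def complete_graph_def)

lemma simple_graph_cycle_graph:
  assumes "n \<ge> 3"
  shows "simple_graph (cycle_graph n)"
proof -
  have "i \<noteq> Suc i mod n" if "i < n" for i
    using that assms by (cases "Suc i = n") auto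
  with assms show ?thesis
    by (auto simp: simple_graph_def cycle_graph_def card_insert_if)
qed

lemma simple_graph_disjoint_union:
  "simple_graph G \<Longrightarrow> simple_graph H \<Longrightarrow> simple_graph (disjoint_union G H)"
  by (fastforce simp: simple_graph_def disjoint_union_def card_image)

lemma simple_graph_complete_union_cycle:
  "l \<ge> 3 \<Longrightarrow> simple_graph (disjoint_union (complete_graph n) (cycle_graph l))"
  by (simp add: simple_graph_disjoint_union simple_graph_complete_graph simple_graph_cycle_graph)

end

theory Submission imports Defs begin

text \<open>
  Orient every edge of a Cayley graph from \<open>x\<close> to \<open>x c\<close>. Left multiplications preserve arrows, up to
  collapsing them. Call \<open>u\<close> a strict predecessor of \<open>v\<close> if there is an arrow from \<open>u\<close> to \<open>v\<close>, but none
  from \<open>v\<close> to \<open>u\<close>; taking strict predecessors twice never leads back to the start.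

  If the unit lies in the clique \<open>A\<close>, then for \<open>x\<close> on the cycle the set \<open>x A\<close> is contained in an edge.
  So \<open>x\<close> has at most one out-neighbour, hence it has a strict predecessor. Two steps to strict
  predecessors give three distinct vertices \<open>x\<close>, \<open>x c\<close>, \<open>x c c'\<close> in one such set, which is absurd.

  If the unit lies on the cycle, then out-degrees are at most 2, so strict predecessors exist in the
  clique. Iterating them yields a closed walk of length \<open>k \<in> {3, 4}\<close> in the clique that never
  backtracks. Its labels, read from the unit, give a walk on the cycle that never backtracks either,
  so it is back at the unit after \<open>l\<close> steps. Hence \<open>l\<close> steps also close up in the clique, which
  fails because \<open>l\<close> is coprime to \<open>k\<close>.
\<close>

section \<open>Arrows and left multiplication on a clique and a cycle\<close>

definition arrow :: "('m, 'b) monoid_scheme \<Rightarrow> 'm set \<Rightarrow> 'm \<Rightarrow> 'm \<Rightarrow> bool" where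
  "arrow M C x y \<longleftrightarrow> x \<in> carrier M \<and> y \<in> carrier M \<and> x \<noteq> y \<and> (\<exists>c\<in>C. y = x \<otimes>\<^bsub>M\<^esub> c)"

definition adjacent :: "('m, 'b) monoid_scheme \<Rightarrow> 'm set \<Rightarrow> 'm \<Rightarrow> 'm \<Rightarrow> bool" where
  "adjacent M C x y \<longleftrightarrow> arrow M C x y \<or> arrow M C y x"

lemma edge_cayley_graph_iff: "{x, y} \<in> edges (cayley_graph M C) \<longleftrightarrow> adjacent M C x y"
  unfolding cayley_graph_def adjacent_def arrow_def
  by (auto simp: doubleton_eq_iff)

text \<open>The cycle is described through its universal cover: \<open>g\<close> winds the integers
  around it, so walks move by 1 or -1, and coincidences become divisibility by
  \<open>l\<close>.\<close>

locale clique_cycle_cayley = monoid M for M (structure) +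
  fixes C A :: "'a set" and g :: "int \<Rightarrow> 'a" and l :: nat
  assumes C_carrier: "C \<subseteq> carrier M"
    and carrier_eq: "carrier M = A \<union> range g"
    and card_clique: "card A = 4"
    and clique_adjacent: "\<And>x y. x \<in> A \<Longrightarrow> y \<in> A \<Longrightarrow> x \<noteq> y \<Longrightarrow> adjacent M C x y"
    and clique_cycle_not_adjacent: "\<And>x i. x \<in> A \<Longrightarrow> \<not> adjacent M C x (g i)"
    and cycle_eq_iff: "\<And>i j. g i = g j \<longleftrightarrow> int l dvd i - j"
    and cycle_adjacent_iff: "\<And>i j. adjacent M C (g i) (g j) \<longleftrightarrow> int l dvd i - j - 1 \<or> int l dvd i - j + 1"
    and l_gt: "l > 1" and l_odd: "\<not> 2 dvd l" and l_not_3: "\<not> 3 dvd l"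
begin

lemma l_ge: "l \<ge> 5"
proof -
  have "l \<noteq> 2" "l \<noteq> 3" "l \<noteq> 4" using l_odd l_not_3 by auto
  with l_gt show ?thesis by simp
qed

text \<open>Serves to rule out coincidences and adjacencies by wrapping around a cycle that has at
  least 5 vertices.\<close>

lemma not_dvd_small: "n \<noteq> 0 \<Longrightarrow> \<bar>n\<bar> < 5 \<Longrightarrow> \<not> int l dvd n"
  using l_ge zdvd_not_zless[of "\<bar>n\<bar>" "int l"] by auto

lemma cycle_neighbour:
  assumes "adjacent M C (g i) x"
  obtains d :: int where "x = g (i + d)" "d = 1 \<or> d = -1"
proof -
  have "x \<in> carrier M" using assms by (auto simp: adjacent_def arrow_def)
  moreover have "x \<notin> A"
    using assms clique_cycle_not_adjacent[of x i] by (auto simp: adjacent_def)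
  ultimately obtain j where x: "x = g j" using carrier_eq by auto
  then consider "int l dvd i - j - 1" | "int l dvd i - j + 1"
    using assms cycle_adjacent_iff by auto
  then show ?thesis
  proof cases
    case 1
    then have "g (i + -1) = g j" by (simp add: cycle_eq_iff algebra_simps)
    then show ?thesis using x that[of "-1"] by simp
  next
    case 2
    then have "g (i + 1) = g j" by (simp add: cycle_eq_iff algebra_simps)
    then show ?thesis using x that[of 1] by simp
  qed
qed

lemma clique_neighbour: "adjacent M C x y \<Longrightarrow> x \<in> A \<Longrightarrow> y \<in> A"
  using clique_cycle_not_adjacent[of x] carrier_eq
  by (metis UnE adjacent_def arrow_def rangeE)

text \<open>By associativity the same label \<open>c\<close> leads from \<open>m \<otimes> x\<close>
  to \<open>m \<otimes> y\<close>; without cancellation the two ends may merge.\<close>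

lemma arrow_mult_left:
  assumes "m \<in> carrier M" "arrow M C x y"
  shows "m \<otimes> x = m \<otimes> y \<or> arrow M C (m \<otimes> x) (m \<otimes> y)"
proof -
  obtain c where "c \<in> C" "y = x \<otimes> c" "x \<in> carrier M" "y \<in> carrier M"
    using assms(2) by (auto simp: arrow_def)
  moreover have "m \<otimes> y = m \<otimes> x \<otimes> c"
    using calculation assms C_carrier by (auto simp: m_assoc)
  ultimately show ?thesis using assms(1) m_closed unfolding arrow_def by metis
qed

lemma adjacent_mult_left:
  assumes "m \<in> carrier M" "adjacent M C x y"
  shows "m \<otimes> x = m \<otimes> y \<or> adjacent M C (m \<otimes> x) (m \<otimes> y)"
  using arrow_mult_left[OF assms(1)] assms(2) unfolding adjacent_def by metis

text \<open>As \<open>x \<otimes> c\<close> differs from \<open>x\<close>, the label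
  \<open>c\<close> is not the unit. So labels of arrows anywhere are neighbours of the unit and lie
  in its component.\<close>

lemma arrowE:
  assumes "arrow M C x y"
  obtains c where "c \<in> C" "c \<in> carrier M" "y = x \<otimes> c" "adjacent M C \<one> c"
proof -
  obtain c where c: "c \<in> C" "y = x \<otimes> c" "x \<in> carrier M" "x \<noteq> y"
    using assms by (auto simp: arrow_def)
  then have "arrow M C \<one> c"
    using C_carrier by (auto simp: arrow_def intro!: bexI[of _ c])
  then show ?thesis using that c C_carrier by (auto simp: adjacent_def)
qed

section \<open>The unit in the clique\<close>

lemma one_notin_clique: "\<one> \<notin> A"
proof
  assume one: "\<one> \<in> A"
  have strict_pred: "\<exists>d. (d = 1 \<or> d = -1) \<and> arrow M C (g (i + d)) (g i) \<and> \<not> arrow M C (g i) (g (i + d))"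
    for i
  proof (rule ccontr)
    assume *: "\<nexists>d. (d = 1 \<or> d = -1) \<and> arrow M C (g (i + d)) (g i) \<and> \<not> arrow M C (g i) (g (i + d))"
    have adj: "adjacent M C (g i) (g (i + d))" if "d = 1 \<or> d = -1" for d
      using that by (auto simp: cycle_adjacent_iff)
    \<comment> \<open>A neighbour joined to \<open>g i\<close> only by an incoming arrow would be a
      strict predecessor.\<close>
    have "arrow M C (g i) (g (i + 1))" "arrow M C (g i) (g (i + -1))"
      using * adj unfolding adjacent_def by blast+
    then obtain c d where c: "g (i + 1) = g i \<otimes> c" "adjacent M C \<one> c"
      and d: "g (i + -1) = g i \<otimes> d" "adjacent M C \<one> d"
      by (metis arrowE)
    have "c \<in> A" "d \<in> A" using c d one clique_neighbour by auto
    moreover have neq: "g (i + 1) \<noteq> g (i + -1)"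
      using not_dvd_small[of 2] by (simp add: cycle_eq_iff)
    ultimately have "adjacent M C c d" using c(1) d(1) clique_adjacent by metis
    \<comment> \<open>Left multiplication by \<open>g i\<close> would carry the clique edge between
      \<open>c\<close> and \<open>d\<close> to an edge between two vertices at distance 2.\<close>
    then have "adjacent M C (g (i + 1)) (g (i + -1))"
      using adjacent_mult_left[of "g i" c d] neq c(1) d(1) carrier_eq by auto
    then show False
      using not_dvd_small[of 1] not_dvd_small[of 3] by (simp add: cycle_adjacent_iff)
  qed
  obtain d where d: "d = 1 \<or> d = -1" "arrow M C (g d) (g 0)" "\<not> arrow M C (g 0) (g d)"
    using strict_pred[of 0] by auto
  obtain d' where d': "d' = 1 \<or> d' = -1" "arrow M C (g (d + d')) (g d)"
    "\<not> arrow M C (g d) (g (d + d'))"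
    using strict_pred[of d] by auto
  \<comment> \<open>Turning back would give an arrow from \<open>g 0\<close> to \<open>g d\<close>,
    against strictness.\<close>
  have "d + d' \<noteq> 0" using d d' by auto
  then have sum: "d + d' = 2 \<or> d + d' = -2" using d(1) d'(1) by auto
  obtain c where c: "g d = g (d + d') \<otimes> c" "adjacent M C \<one> c" "c \<in> carrier M"
    using d'(2) by (rule arrowE)
  obtain c' where c': "g 0 = g d \<otimes> c'" "adjacent M C \<one> c'" "c' \<in> carrier M"
    using d(2) by (rule arrowE)
  have "c \<in> A" using c one clique_neighbour by blast
  moreover have "c = c \<otimes> c' \<or> adjacent M C c (c \<otimes> c')"
    using adjacent_mult_left[OF c(3) c'(2)] c(3) by simp
  ultimately have cc': "c \<otimes> c' \<in> A" using clique_neighbour by metis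
  have g0: "g 0 = g (d + d') \<otimes> (c \<otimes> c')"
    using c c' carrier_eq by (auto simp: m_assoc)
  have neq: "g 0 \<noteq> g (d + d')"
    using sum not_dvd_small[of "- (d + d')"] by (auto simp: cycle_eq_iff)
  then have "c \<otimes> c' \<noteq> \<one>" using g0 carrier_eq by auto
  \<comment> \<open>Multiplied by \<open>g (d + d')\<close>, this clique edge would join
    \<open>g (d + d')\<close> to \<open>g 0\<close>, again at distance 2.\<close>
  then have "adjacent M C (c \<otimes> c') \<one>" using one cc' clique_adjacent by auto
  then have "adjacent M C (g 0) (g (d + d'))"
    using adjacent_mult_left[of "g (d + d')" "c \<otimes> c'" \<one>] g0 neq carrier_eq by auto
  then show False
    using sum not_dvd_small[of "- (d + d') - 1"] not_dvd_small[of "- (d + d') + 1"]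
    by (auto simp: cycle_adjacent_iff)
qed

section \<open>The unit on the cycle\<close>

lemma cycle_walk_closed:
  fixes s :: "nat \<Rightarrow> 'a"
  assumes s0: "s 0 = g i"
    and adj: "\<And>n. adjacent M C (s n) (s (Suc n))"
    and nb: "\<And>n. s (Suc (Suc n)) \<noteq> s n"
  shows "s l = s 0"
proof -
  obtain d where d: "s 1 = g (i + d)" "d = 1 \<or> d = -1"
    using adj[of 0] s0 by (auto elim: cycle_neighbour)
  \<comment> \<open>The first direction \<open>d\<close> persists, since a turn would revisit
    \<open>s n\<close>. The induction carries two consecutive positions so that the latest direction
    is known.\<close>
  have "s n = g (i + d * int n) \<and> s (Suc n) = g (i + d * int (Suc n))" for n
  proof (induction n)
    case 0
    then show ?case using s0 d by simp
  next
    case (Suc n)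
    let ?j = "i + d * int (Suc n)"
    obtain d' where d': "s (Suc (Suc n)) = g (?j + d')" "d' = 1 \<or> d' = -1"
      using adj[of "Suc n"] Suc by (metis cycle_neighbour)
    have "d' \<noteq> -d"
      using nb[of n] Suc d' by (auto simp: algebra_simps)
    then have "d' = d" using d d' by auto
    then show ?case using Suc d' by (simp add: algebra_simps)
  qed
  then have "s l = g (i + d * int l)" by blast
  also have "\<dots> = g i" by (simp add: cycle_eq_iff)
  finally show ?thesis using s0 by simp
qed

lemma one_notin_cycle: "\<one> \<noteq> g i"
proof
  assume one: "\<one> = g i"
  have "\<exists>y. y \<in> A \<and> arrow M C y x \<and> \<not> arrow M C x y" if x: "x \<in> A" for x
  proof -
    have out: "y = x \<otimes> g (i + 1) \<or> y = x \<otimes> g (i + -1)" if "arrow M C x y" for y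
      using that one by (metis arrowE cycle_neighbour)
    \<comment> \<open>Four clique vertices leave some \<open>y\<close> other than \<open>x\<close>
      with no arrow from \<open>x\<close>; completeness forces an arrow from \<open>y\<close> to
      \<open>x\<close>.\<close>
    have "card {x, x \<otimes> g (i + 1), x \<otimes> g (i + -1)} < card A"
      using card_clique by (auto simp: card_insert_if)
    then obtain y where "y \<in> A" "y \<notin> {x, x \<otimes> g (i + 1), x \<otimes> g (i + -1)}"
      by (metis card_mono finite.emptyI finite.insertI linorder_not_le subsetI)
    then show ?thesis using out clique_adjacent[OF x, of y] unfolding adjacent_def by auto
  qed
  then obtain p where p: "\<And>x. x \<in> A \<Longrightarrow> p x \<in> A" "\<And>x. x \<in> A \<Longrightarrow> arrow M C (p x) x"
    "\<And>x. x \<in> A \<Longrightarrow> \<not> arrow M C x (p x)"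
    by metis
  have p1: "p x \<noteq> x" and p2: "p (p x) \<noteq> x" if "x \<in> A" for x
    using p that by (auto simp: arrow_def) metis
  have pow_A: "(p ^^ n) x \<in> A" if "x \<in> A" for n x
    using that by (induction n) (auto simp: p)
  obtain a where a: "a \<in> A" using card_clique by fastforce
  \<comment> \<open>Pigeonhole: five iterates in a set of four elements.\<close>
  have "\<not> inj_on (\<lambda>n. (p ^^ n) a) {..4}"
  proof
    assume "inj_on (\<lambda>n. (p ^^ n) a) {..4}"
    then have "card {..4::nat} \<le> card A"
      using pow_A[OF a] card_clique by (intro card_inj_on_le) (auto intro: card_ge_0_finite)
    then show False using card_clique by simp
  qed
  then obtain m n where mn: "m < n" "n \<le> 4" "(p ^^ m) a = (p ^^ n) a"
    unfolding inj_on_def by (metis atMost_iff nat_neq_iff)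
  define x k where "x = (p ^^ m) a" and "k = n - m"
  have x: "x \<in> A" using pow_A a by (simp add: x_def)
  have "n = k + m" using mn by (simp add: k_def)
  then have per: "(p ^^ k) x = x"
    using mn(3) by (simp add: x_def funpow_add)
  have "k \<noteq> 0" "k \<le> 4" using mn by (auto simp: k_def)
  moreover have "k \<noteq> 1" "k \<noteq> 2" using per p1[OF x] p2[OF x] by (auto simp: numeral_2_eq_2)
  ultimately have k: "k = 3 \<or> k = 4" by auto

  \<comment> \<open>\<open>p\<close> runs against the arrows; on its periodic orbit, \<open>p ^^ (k - 1)\<close> inverts it.\<close>
  define y where "y n = (p ^^ ((k - 1) * n)) x" for n
  have y_A: "y n \<in> A" for n using pow_A x by (simp add: y_def)
  have p_y: "p (y (Suc n)) = y n" for n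
  proof -
    have "Suc ((k - 1) * Suc n) = (k - 1) * n + k" using \<open>k \<noteq> 0\<close> by (cases k) auto
    then have "p (y (Suc n)) = (p ^^ ((k - 1) * n + k)) x"
      unfolding y_def by (metis comp_apply funpow.simps(2))
    then show ?thesis using per by (simp add: funpow_add y_def)
  qed
  have "\<exists>c. c \<in> C \<and> y (Suc n) = y n \<otimes> c" for n
    using p(2)[OF y_A[of "Suc n"]] p_y[of n] by (auto simp: arrow_def)
  then obtain c where c: "\<And>n. c n \<in> C" "\<And>n. y (Suc n) = y n \<otimes> c n" by metis
  \<comment> \<open>The labels of the walk \<open>y\<close> are replayed from the unit. Left
    multiplication by \<open>x\<close> maps \<open>s\<close> onto \<open>y\<close>, so distinct
    terms of \<open>y\<close> come from distinct terms of \<open>s\<close>.\<close>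
  define s where "s = rec_nat \<one> (\<lambda>n t. t \<otimes> c n)"
  have s0: "s 0 = \<one>" and s_Suc: "s (Suc n) = s n \<otimes> c n" for n by (simp_all add: s_def)
  have s_carrier: "s n \<in> carrier M" for n
    using c(1) C_carrier by (induction n) (auto simp: s0 s_Suc)
  have x_s: "x \<otimes> s n = y n" for n
  proof (induction n)
    case 0
    then show ?case using x carrier_eq by (simp add: s0 y_def)
  next
    case (Suc n)
    have "x \<otimes> s (Suc n) = x \<otimes> s n \<otimes> c n"
      using m_assoc[of x "s n" "c n"] x carrier_eq s_carrier[of n] c(1)[of n] C_carrier
      by (auto simp: s_Suc)
    then show ?case using Suc c(2) by simp
  qed
  have "s l = s 0"
  proof (rule cycle_walk_closed)
    show "s 0 = g i" using s0 one by simp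
    show "adjacent M C (s n) (s (Suc n))" for n
    proof -
      have "y n \<noteq> y (Suc n)" using p1[OF y_A[of "Suc n"]] p_y[of n] by simp
      then have "s n \<noteq> s (Suc n)" using x_s by metis
      then show ?thesis
        using s_carrier[of n] s_carrier[of "Suc n"] c(1)[of n] s_Suc[of n]
        unfolding adjacent_def arrow_def by blast
    qed
    show "s (Suc (Suc n)) \<noteq> s n" for n
      using p2[OF y_A[of "Suc (Suc n)"]] p_y x_s by metis
  qed
  then have yl: "y l = x" using x_s[of l] s0 x carrier_eq by simp
  \<comment> \<open>Each \<open>p\<close> undoes one step of \<open>y\<close>, so closure of
    \<open>y\<close> after \<open>l\<close> steps says that \<open>p ^^ l\<close> fixes
    \<open>x\<close>.\<close>
  have "(p ^^ n) (y n) = x" for n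
    by (induction n) (simp_all add: y_def[of 0] p_y funpow_Suc_right del: funpow.simps(2))
  then have "(p ^^ l) x = x" using yl by metis
  then have r: "(p ^^ (l mod k)) x = x" using funpow_mod_eq[OF per] by simp
  have "l mod 3 = 1 \<or> l mod 3 = 2" "l mod 4 = 1 \<or> l mod 4 = 3" using l_odd l_not_3 by presburger+
  then consider "l mod k = 1" | "l mod k = 2" | "k = 4" "l mod k = 3" using k by auto
  then show False
  proof cases
    case 1
    then show ?thesis using r p1[OF x] by simp
  next
    case 2
    then show ?thesis using r p2[OF x] by (simp add: numeral_2_eq_2)
  next
    case 3
    \<comment> \<open>Both 3 and 4 iterations fix \<open>x\<close>, hence so does a single
      \<open>p\<close>.\<close>
    then have "(p ^^ 3) x = x" "(p ^^ Suc 3) x = x" using r per by simp_all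
    then show ?thesis using p1[OF x] by (simp only: funpow.simps(2) comp_apply)
  qed
qed

lemma inconsistent: False
  using one_closed carrier_eq one_notin_clique one_notin_cycle by auto

end

section \<open>From the concrete disjoint union to the locale\<close>

lemma edge_image_iff:
  assumes "inj_on f V" "\<And>e. e \<in> E \<Longrightarrow> e \<subseteq> V" "u \<in> V" "v \<in> V"
  shows "{f u, f v} \<in> (`) f ` E \<longleftrightarrow> {u, v} \<in> E"
proof -
  have "f ` {u, v} \<in> (`) f ` E \<longleftrightarrow> {u, v} \<in> E"
    using inj_on_image_mem_iff[OF inj_on_image_Pow[OF assms(1)], of "{u, v}" E] assms by blast
  then show ?thesis by simp
qed

lemma edge_disjoint_union_simps:
  "{Inl i, Inl j} \<in> edges (disjoint_union G H) \<longleftrightarrow> {i, j} \<in> edges G"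
  "{Inr i', Inr j'} \<in> edges (disjoint_union G H) \<longleftrightarrow> {i', j'} \<in> edges H"
  "{Inl i, Inr j'} \<notin> edges (disjoint_union G H)"
proof -
  have l: "Inl ` e = {Inl i, Inl j} \<longleftrightarrow> e = {i, j}" for e :: "'a set"
    using inj_image_eq_iff[OF inj_Inl, of e "{i, j}"] by auto
  have r: "Inr ` e = {Inr i', Inr j'} \<longleftrightarrow> e = {i', j'}" for e :: "'b set"
    using inj_image_eq_iff[OF inj_Inr, of e "{i', j'}"] by auto
  show "{Inl i, Inl j} \<in> edges (disjoint_union G H) \<longleftrightarrow> {i, j} \<in> edges G"
    using l by (auto simp: disjoint_union_def image_iff eq_commute[of "{Inl i, Inl j}"])
  show "{Inr i', Inr j'} \<in> edges (disjoint_union G H) \<longleftrightarrow> {i', j'} \<in> edges H"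
    using r by (auto simp: disjoint_union_def image_iff eq_commute[of "{Inr i', Inr j'}"])
  show "{Inl i, Inr j'} \<notin> edges (disjoint_union G H)"
    by (auto simp: disjoint_union_def)
qed

text \<open>The two divisibilities correspond to the two ends from which the successor step of an
  edge can be read.\<close>

lemma edge_cycle_graph_mod_iff:
  assumes "l > 0"
  shows "{nat (i mod int l), nat (j mod int l)} \<in> edges (cycle_graph l) \<longleftrightarrow>
    int l dvd i - j - 1 \<or> int l dvd i - j + 1"
proof -
  have suc: "nat (i mod int l) = Suc (nat (j mod int l)) mod l \<longleftrightarrow> int l dvd i - j - 1" for i j
  proof -
    have "nat (i mod int l) = Suc (nat (j mod int l)) mod l \<longleftrightarrow>
        i mod int l = int (Suc (nat (j mod int l)) mod l)"
      using assms by (simp add: nat_eq_iff)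
    also have "int (Suc (nat (j mod int l)) mod l) = (j + 1) mod int l"
      using assms by (simp add: zmod_int mod_simps add.commute)
    also have "i mod int l = (j + 1) mod int l \<longleftrightarrow> int l dvd i - j - 1"
      by (simp add: mod_eq_dvd_iff algebra_simps)
    finally show ?thesis .
  qed
  have lt: "nat (i mod int l) < l" for i
    using assms by (simp add: nat_less_iff)
  have "{nat (i mod int l), nat (j mod int l)} \<in> edges (cycle_graph l) \<longleftrightarrow>
      nat (i mod int l) = Suc (nat (j mod int l)) mod l \<or> nat (j mod int l) = Suc (nat (i mod int l)) mod l"
    using lt by (auto simp: cycle_graph_def doubleton_eq_iff)
  also have "\<dots> \<longleftrightarrow> int l dvd i - j - 1 \<or> int l dvd j - i - 1"
    by (simp only: suc)
  also have "int l dvd j - i - 1 \<longleftrightarrow> int l dvd i - j + 1"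
    using dvd_minus_iff[of "int l" "j - i - 1"] by (simp add: algebra_simps)
  finally show ?thesis .
qed

theorem proposition4p7:
  fixes l :: nat
  assumes "l > 1" and "\<not> 2 dvd l" and "\<not> 3 dvd l"
  shows "\<not> monoid_graph TYPE('m) (disjoint_union (complete_graph 4) (cycle_graph l))"
proof
  let ?G = "disjoint_union (complete_graph 4) (cycle_graph l)"
  assume "monoid_graph TYPE('m) ?G"
  then obtain M :: "'m monoid" and C f where G: "simple_graph ?G" and M: "monoid M" "C \<subseteq> carrier M"
    and bij: "bij_betw f (verts ?G) (carrier M)"
    and edg: "edges (cayley_graph M C) = (`) f ` edges ?G"
    by (auto simp: monoid_graph_def graph_iso_def cayley_graph_def)
  have V: "verts ?G = Inl ` {..<4} \<union> Inr ` {..<l}"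
    by (auto simp: disjoint_union_def complete_graph_def cycle_graph_def)
  have inj: "inj_on f (verts ?G)" using bij by (rule bij_betw_imp_inj_on)
  have sub: "e \<subseteq> verts ?G" if "e \<in> edges ?G" for e
    using G that by (auto simp: simple_graph_def)
  have adj: "adjacent M C (f u) (f v) \<longleftrightarrow> {u, v} \<in> edges ?G"
    if "u \<in> verts ?G" "v \<in> verts ?G" for u v
    using edge_image_iff[OF inj sub that] edg by (simp add: edge_cayley_graph_iff[symmetric])
  \<comment> \<open>For positive \<open>l\<close> the residue is nonnegative, so \<open>nat\<close>
    loses nothing and \<open>r\<close> winds the integers around the vertices of the cycle.\<close>
  define r where "r i = nat (i mod int l)" for i
  have r_lt: "r i < l" for i using assms(1) by (simp add: r_def nat_less_iff)
  have r_range: "range r = {..<l}"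
  proof
    show "range r \<subseteq> {..<l}" using r_lt by auto
    have "n = r (int n)" if "n < l" for n using that by (simp add: r_def)
    then show "{..<l} \<subseteq> range r" by blast
  qed
  have r_V: "Inr (r i) \<in> verts ?G" for i using r_lt V by auto
  define A where "A = f ` Inl ` {..<4}"
  define g where "g i = f (Inr (r i))" for i
  have "range g = f ` Inr ` {..<l}" by (simp add: g_def r_range[symmetric] image_image)
  then have car: "carrier M = A \<union> range g"
    using bij V by (auto simp: A_def bij_betw_def image_Un)
  have "clique_cycle_cayley M C A g l"
  proof (intro clique_cycle_cayley.intro clique_cycle_cayley_axioms.intro)
    have "inj_on f (Inl ` {..<4})" using inj V by (auto intro: inj_on_subset)
    then show "card A = 4" by (simp add: A_def card_image)
    show "adjacent M C x y" if xy: "x \<in> A" "y \<in> A" "x \<noteq> y" for x y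
    proof -
      obtain i j where "x = f (Inl i)" "y = f (Inl j)" "i < 4" "j < 4" using xy by (auto simp: A_def)
      then show ?thesis
        using xy(3) V by (auto simp: adj edge_disjoint_union_simps complete_graph_def)
    qed
    show "\<not> adjacent M C x (g i)" if "x \<in> A" for x i
      using that V r_V by (auto simp: A_def g_def adj edge_disjoint_union_simps)
    show "g i = g j \<longleftrightarrow> int l dvd i - j" for i j
    proof -
      have "g i = g j \<longleftrightarrow> r i = r j"
        using inj_on_eq_iff[OF inj r_V r_V] by (simp add: g_def)
      also have "\<dots> \<longleftrightarrow> i mod int l = j mod int l"
        using assms(1) by (simp add: r_def eq_nat_nat_iff)
      finally show ?thesis by (simp add: mod_eq_dvd_iff)
    qed
    show "adjacent M C (g i) (g j) \<longleftrightarrow> int l dvd i - j - 1 \<or> int l dvd i - j + 1" for i j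
      using edge_cycle_graph_mod_iff[of l i j] assms(1) r_V
      by (simp add: g_def adj edge_disjoint_union_simps) (simp add: r_def)
  qed (use M car assms in auto)
  then show False by (rule clique_cycle_cayley.inconsistent)
qed

end
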